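(* Every infinite, finitely generated group $G$ has a finite generating set $S$ with respect to which $G$ has dead ends. Moreover, if $G$ is generated by $m$ elements, $S$ can be chosen with $|S|\le 4m+2$.
   Context: For a group $G$ generated by a finite set $S$, the word length $\ell_S(g)$ of $g\in G$ is the minimal $k$ such that $g=s_1s_2\cdots s_k$ with $s_i\in S\cup S^{-1}$. A dead end in $G$ with respect to $S$ is an element $d\in G$ such that $\ell_S(ds)\le\ell_S(d)$ for every $s\in S\cup S^{-1}$. *)

theory Defs
  imports "HOL-Algebra.Algebra"
begin

definition finite_generating_set :: "('a, 'b) monoid_scheme \<Rightarrow> 'a set \<Rightarrow> bool" where
  "finite_generating_set G S \<longleftrightarrow> finite S \<and> S \<subseteq> carrier G \<and> generate G S = carrier G"

(* Words are lists of letters, and foldr multiplies them out in order: [s1,...,sk] denotes s1...sk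
   and the empty word denotes the identity.  LEAST is unspecified on elements represented by no
   word; none exist in the carrier when S generates G. *)
definition word_length :: "('a, 'b) monoid_scheme \<Rightarrow> 'a set \<Rightarrow> 'a \<Rightarrow> nat" where
  "word_length G S g =
    (LEAST k. \<exists>w. length w = k \<and> set w \<subseteq> S \<union> set_inv\<^bsub>G\<^esub> S
       \<and> foldr (\<otimes>\<^bsub>G\<^esub>) w \<one>\<^bsub>G\<^esub> = g)"

definition dead_end :: "('a, 'b) monoid_scheme \<Rightarrow> 'a set \<Rightarrow> 'a \<Rightarrow> bool" where
  "dead_end G S d \<longleftrightarrow> d \<in> carrier G \<and>
    (\<forall>s \<in> S \<union> set_inv\<^bsub>G\<^esub> S. word_length G S (d \<otimes>\<^bsub>G\<^esub> s) \<le> word_length G S d)"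

end

theory Submission
  imports Defs
begin

text \<open>
The dead end is an element \<open>d\<close> of length two such that every \<open>d s\<close> has length at most two.
Given generators \<open>A\<close>, take \<open>S = U \<union> {x a y\<inverse> | a \<in> A, x, y \<in> K}\<close> with \<open>K = {1, c}\<close> and
\<open>\<bar>U\<bar> \<le> 2\<close>; if left multiplication by \<open>d\<close> maps \<open>K\<close> into \<open>({1} \<union> U\<^sup>\<plusminus>) K\<close>, then
\<open>d x a y\<inverse>\<close> has length at most two.

If \<open>d\<^sup>3 \<noteq> 1\<close> and \<open>d, d\<^sup>2 \<notin> A\<^sup>\<plusminus>\<close>, then \<open>c = d\<close> and \<open>U = {d\<^sup>2, d\<^sup>3}\<close> work (without \<open>d\<^sup>3\<close> if
\<open>d\<^sup>4 = 1\<close>). If there is no such \<open>d\<close>, either some \<open>a \<in> A\<close> has infinitely many square roots,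
or all but finitely many elements satisfy \<open>g\<^sup>3 = 1\<close>. In the first case, with \<open>A\<close> irredundant,
replacing \<open>a\<close> by \<open>a b\<close> for another generator \<open>b\<close> removes \<open>a\<close> from \<open>A\<^sup>\<plusminus>\<close>, so that a square
root of \<open>a\<close> can serve as \<open>d\<close>. In the second case there are commuting \<open>u, v\<close> of order three,
because \<open>x\<close> commutes with \<open>y\<inverse> x y\<close> in exponent three, and \<open>d = u v\<close>, \<open>c = u v\<inverse>\<close>, \<open>U = {u, v}\<close>
work.
\<close>

lemma infinite_imp_elem: "infinite S \<Longrightarrow> \<exists>x. x \<in> S"
  using infinite_imp_nonempty by blast

context group
begin

lemma cancel_inv [simp]:
  assumes "x \<in> carrier G" "y \<in> carrier G"
  shows "x \<otimes> (inv x \<otimes> y) = y" "inv x \<otimes> (x \<otimes> y) = y"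
  using assms by (simp_all flip: m_assoc)

section \<open>Word length and dead ends of length two\<close>

lemma word_length_le:
  assumes "set w \<subseteq> S \<union> set_inv S"
  shows "word_length G S (foldr (\<otimes>) w \<one>) \<le> length w"
  unfolding word_length_def using assms by (intro Least_le) auto

text \<open>The word \<open>w\<close> makes the \<open>LEAST\<close> attained. A shortest word for
  \<open>d\<close> is then neither empty nor a single letter.\<close>

lemma word_length_ge_2:
  assumes "S \<subseteq> carrier G" "set w \<subseteq> S \<union> set_inv S" "foldr (\<otimes>) w \<one> = d"
    and "d \<noteq> \<one>" "d \<notin> S \<union> set_inv S"
  shows "2 \<le> word_length G S d"
proof -
  let ?P = "\<lambda>k. \<exists>w. length w = k \<and> set w \<subseteq> S \<union> set_inv S \<and> foldr (\<otimes>) w \<one> = d"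
  have "?P (LEAST k. ?P k)"
    by (rule LeastI_ex) (use assms in blast)
  then obtain v where v: "length v = word_length G S d" "set v \<subseteq> S \<union> set_inv S"
      "foldr (\<otimes>) v \<one> = d"
    unfolding word_length_def by blast
  have "set v \<subseteq> carrier G"
    using v(2) assms(1) by (auto simp: SET_INV_def)
  then have "v \<noteq> []" "\<And>s. v \<noteq> [s]"
    using v assms(4,5) by auto
  then have "length v \<ge> 2"
    by (cases v; cases "tl v") auto
  then show ?thesis using v(1) by simp
qed

text \<open>The bound \<open>2\<close> separates the two lengths: \<open>d\<close> needs at least
  two letters, and \<open>prod\<close> writes each \<open>d \<otimes> s\<close> with at most
  two.\<close>

lemma dead_end_of_length_2:
  assumes "S \<subseteq> carrier G" "d \<in> carrier G"
    and "set w \<subseteq> S \<union> set_inv S" "foldr (\<otimes>) w \<one> = d"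
    and "d \<noteq> \<one>" "d \<notin> S \<union> set_inv S"
    and prod: "\<And>s. s \<in> S \<union> set_inv S \<Longrightarrow>
      \<exists>t \<in> insert \<one> (S \<union> set_inv S). \<exists>r \<in> insert \<one> (S \<union> set_inv S). d \<otimes> s = t \<otimes> r"
  shows "dead_end G S d"
  unfolding dead_end_def
proof (intro conjI ballI)
  fix s assume "s \<in> S \<union> set_inv S"
  then obtain t r where tr: "t \<in> insert \<one> (S \<union> set_inv S)" "r \<in> insert \<one> (S \<union> set_inv S)"
      "d \<otimes> s = t \<otimes> r"
    using prod by blast
  have "t \<in> carrier G" "r \<in> carrier G"
    using tr assms(1) by (auto simp: SET_INV_def)
  \<comment> \<open>Factors equal to \<open>\<one>\<close> are dropped because \<open>\<one>\<close>
    need not be a letter.\<close>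
  moreover define v where "v = filter (\<lambda>z. z \<noteq> \<one>) [t, r]"
  ultimately have "foldr (\<otimes>) v \<one> = d \<otimes> s" "set v \<subseteq> S \<union> set_inv S" "length v \<le> 2"
    using tr by auto
  then have "word_length G S (d \<otimes> s) \<le> 2"
    using word_length_le[of v S] by simp
  also have "2 \<le> word_length G S d"
    using assms word_length_ge_2 by blast
  finally show "word_length G S (d \<otimes> s) \<le> word_length G S d" .
qed (use assms in simp)

section \<open>Generators flanked by a small set\<close>

definition conj_set :: "'a set \<Rightarrow> 'a set \<Rightarrow> 'a set" where
  "conj_set K B = (\<lambda>(x, b, y). x \<otimes> b \<otimes> inv y) ` (K \<times> B \<times> K)"

lemma conj_set_iff:
  "z \<in> conj_set K B \<longleftrightarrow> (\<exists>x \<in> K. \<exists>b \<in> B. \<exists>y \<in> K. z = x \<otimes> b \<otimes> inv y)"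
  by (force simp: conj_set_def)

text \<open>Inversion turns \<open>x b y\<inverse>\<close> into
  \<open>y b\<inverse> x\<inverse>\<close>, and both outer factors range independently over the same
  \<open>K\<close>.\<close>

lemma set_inv_conj_set:
  assumes "K \<subseteq> carrier G" "B \<subseteq> carrier G"
  shows "set_inv (conj_set K B) = conj_set K (set_inv B)"
proof (intro equalityI subsetI)
  have eq: "inv (x \<otimes> b \<otimes> inv y) = y \<otimes> inv b \<otimes> inv x" if "x \<in> K" "b \<in> B" "y \<in> K" for x b y
    using that assms by (simp add: subset_iff inv_mult_group m_assoc)
  {
    fix z assume "z \<in> set_inv (conj_set K B)"
    then obtain w where w: "w \<in> conj_set K B" "z = inv w"
      by (auto simp: SET_INV_def)
    then obtain x b y where xby: "x \<in> K" "b \<in> B" "y \<in> K" "w = x \<otimes> b \<otimes> inv y"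
      unfolding conj_set_iff by blast
    then have "inv b \<in> set_inv B" "z = y \<otimes> inv b \<otimes> inv x"
      using w(2) eq by (auto simp: SET_INV_def)
    then show "z \<in> conj_set K (set_inv B)"
      using xby unfolding conj_set_iff by blast
  next
    fix z assume "z \<in> conj_set K (set_inv B)"
    then obtain y c x where "y \<in> K" "c \<in> set_inv B" "x \<in> K" "z = y \<otimes> c \<otimes> inv x"
      unfolding conj_set_iff by blast
    then obtain b where yb: "y \<in> K" "b \<in> B" "x \<in> K" "z = y \<otimes> inv b \<otimes> inv x"
      by (auto simp: SET_INV_def)
    then have "x \<otimes> b \<otimes> inv y \<in> conj_set K B" "z = inv (x \<otimes> b \<otimes> inv y)"
      using eq unfolding conj_set_iff by auto
    then show "z \<in> set_inv (conj_set K B)"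
      unfolding SET_INV_def by blast
  }
qed

lemma card_conj_set:
  assumes "finite K" "finite B"
  shows "card (conj_set K B) \<le> card K * card B * card K"
  unfolding conj_set_def
  using card_image_le[of "K \<times> B \<times> K"] assms by (simp add: card_cartesian_product mult.assoc)

lemma symmetrize_conj_set:
  assumes "K \<subseteq> carrier G" "A \<subseteq> carrier G"
  shows "(U \<union> conj_set K A) \<union> set_inv (U \<union> conj_set K A)
    = (U \<union> set_inv U) \<union> conj_set K (A \<union> set_inv A)"
proof -
  have "set_inv (U \<union> conj_set K A) = set_inv U \<union> conj_set K (set_inv A)"
    using set_inv_conj_set[OF assms] by (auto simp: SET_INV_def)
  moreover have "conj_set K (A \<union> set_inv A) = conj_set K A \<union> conj_set K (set_inv A)"
    unfolding set_eq_iff Un_iff conj_set_iff by blast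
  ultimately show ?thesis by blast
qed

lemma generating_set_superset:
  assumes "finite_generating_set G A" "A \<subseteq> S" "finite S" "S \<subseteq> carrier G"
  shows "finite_generating_set G S"
  using assms mono_generate[of A S] generate_incl[of S] unfolding finite_generating_set_def by blast

text \<open>For a letter \<open>s = x b y\<inverse>\<close> with \<open>d x = v y'\<close>, one gets
  \<open>d s = v (y' b y\<inverse>)\<close>, an element of \<open>V\<close> times a letter. The
  condition on \<open>inv x \<otimes> d \<otimes> y\<close> says that \<open>d\<close> is no letter
  of this form, and \<open>dU\<close> treats the letters from \<open>U\<close>. With two elements in
  \<open>K\<close> and at most two in \<open>U\<close>, the cardinality bound becomes
  \<open>4 * card A + 2\<close>.\<close>

lemma dead_end_conj_set:
  fixes A U K d
  defines "V \<equiv> insert \<one> (U \<union> set_inv U)"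
  defines "S \<equiv> U \<union> conj_set K A"
  assumes A: "finite_generating_set G A" "A \<noteq> {}"
    and U: "finite U" "U \<subseteq> carrier G"
    and K: "finite K" "K \<subseteq> carrier G" "\<one> \<in> K"
    and d: "d \<in> carrier G" "d \<notin> V" "\<And>x y. x \<in> K \<Longrightarrow> y \<in> K \<Longrightarrow> inv x \<otimes> d \<otimes> y \<notin> A \<union> set_inv A"
    and dK: "\<And>x. x \<in> K \<Longrightarrow> \<exists>v \<in> V. \<exists>y \<in> K. d \<otimes> x = v \<otimes> y"
    and dU: "\<And>u. u \<in> U \<union> set_inv U \<Longrightarrow>
      (\<exists>v \<in> V. \<exists>r \<in> V. d \<otimes> u = v \<otimes> r) \<or> (\<exists>x \<in> K. \<exists>y \<in> K. d \<otimes> u = x \<otimes> inv y)"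
  shows "finite_generating_set G S" "dead_end G S d"
    "card S \<le> card U + card K * card A * card K"
proof -
  have AG: "A \<subseteq> carrier G" "finite A"
    using A by (auto simp: finite_generating_set_def)
  define B where "B = A \<union> set_inv A"
  have BG: "B \<subseteq> carrier G"
    using AG by (auto simp: B_def SET_INV_def)
  have T: "S \<union> set_inv S = (U \<union> set_inv U) \<union> conj_set K B"
    using symmetrize_conj_set[OF K(2) AG(1)] by (simp add: S_def B_def)
  have conj_mem: "x \<otimes> b \<otimes> inv y \<in> conj_set K B" if "x \<in> K" "b \<in> B" "y \<in> K" for x b y
    using that by (force simp: conj_set_def)
  have "A \<subseteq> conj_set K A"
  proof
    fix a assume a: "a \<in> A"
    then have "a = \<one> \<otimes> a \<otimes> inv \<one>" using AG by auto
    then show "a \<in> conj_set K A"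
      using a K(3) unfolding conj_set_def by (force simp: image_iff)
  qed
  have "conj_set K A \<subseteq> carrier G"
    using K(2) AG by (auto simp: conj_set_def subset_iff)
  then have SG: "S \<subseteq> carrier G" using U by (simp add: S_def)
  have "finite S" using U K AG by (simp add: S_def conj_set_def)
  then show "finite_generating_set G S"
    using generating_set_superset[OF A(1) _ _ SG] \<open>A \<subseteq> conj_set K A\<close> by (auto simp: S_def)
  show "card S \<le> card U + card K * card A * card K"
    using card_Un_le[of U "conj_set K A"] card_conj_set[OF K(1) AG(2)] by (simp add: S_def)
  have VG: "V \<subseteq> carrier G" using U by (auto simp: V_def SET_INV_def)
  have VT: "V \<subseteq> insert \<one> (S \<union> set_inv S)" by (auto simp: V_def T)
  obtain a where a: "a \<in> A" "a \<in> carrier G" using A(2) AG by blast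
  have aB: "a \<in> B" "inv a \<in> B" using a by (auto simp: B_def SET_INV_def)
  \<comment> \<open>Inserting \<open>a a\<inverse>\<close> makes every quotient
    \<open>x y\<inverse>\<close> of elements of \<open>K\<close> a product of two letters.\<close>
  have prodX: "x \<otimes> inv y = (x \<otimes> a \<otimes> inv \<one>) \<otimes> (\<one> \<otimes> inv a \<otimes> inv y)" if "x \<in> K" "y \<in> K" for x y
    using that K a by (simp add: subset_iff m_assoc)
  have split: "\<exists>t \<in> conj_set K B. \<exists>r \<in> conj_set K B. x \<otimes> inv y = t \<otimes> r"
    if "x \<in> K" "y \<in> K" for x y
    using prodX[OF that] conj_mem aB K(3) that by meson
  show "dead_end G S d"
  proof -
    \<comment> \<open>Some word for \<open>d\<close> is required, of any length:
      \<open>d = v y\<close>, where \<open>y\<close> splits into two letters.\<close>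
    obtain v y where vy: "v \<in> V" "y \<in> K" "d \<otimes> \<one> = v \<otimes> y"
      using dK K(3) by blast
    obtain t r where tr: "t \<in> conj_set K B" "r \<in> conj_set K B" "y \<otimes> inv \<one> = t \<otimes> r"
      using split[OF vy(2) K(3)] by blast
    have cB: "conj_set K B \<subseteq> carrier G"
      using K(2) BG by (auto simp: conj_set_def subset_iff)
    have car: "t \<in> carrier G" "r \<in> carrier G" "v \<in> carrier G" "y \<in> carrier G"
      using tr vy cB VG K(2) by auto
    define w where "w = (if v = \<one> then [] else [v]) @ [t, r]"
    have w: "set w \<subseteq> S \<union> set_inv S"
      using vy(1) tr VT by (auto simp: w_def T)
    have "foldr (\<otimes>) w \<one> = d"
      using vy(3) tr(3) car d(1) by (auto simp: w_def)
    moreover have "d \<noteq> \<one>" using d(2) by (simp add: V_def)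
    moreover have "d \<notin> S \<union> set_inv S"
    proof
      assume "d \<in> S \<union> set_inv S"
      then have "d \<in> conj_set K B" using d(2) by (auto simp: T V_def)
      then obtain x b z where xbz: "x \<in> K" "b \<in> B" "z \<in> K" "d = x \<otimes> b \<otimes> inv z"
        by (auto simp: conj_set_def)
      then have "inv x \<otimes> d \<otimes> z = b"
        using K(2) BG by (simp add: subset_iff m_assoc)
      then show False using d(3)[OF xbz(1,3)] xbz(2) by (simp add: B_def)
    qed
    moreover have "\<exists>t \<in> insert \<one> (S \<union> set_inv S). \<exists>r \<in> insert \<one> (S \<union> set_inv S). d \<otimes> s = t \<otimes> r"
      if s: "s \<in> S \<union> set_inv S" for s
    proof (cases "s \<in> U \<union> set_inv U")
      case True
      then show ?thesis
        using dU[OF True]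
      proof (elim disjE bexE)
        fix x y assume xy: "x \<in> K" "y \<in> K" "d \<otimes> s = x \<otimes> inv y"
        then show ?thesis
          using split[OF xy(1,2)] unfolding T by fastforce
      qed (use VT in blast)
    next
      case False
      then obtain x b z where xbz: "x \<in> K" "b \<in> B" "z \<in> K" "s = x \<otimes> b \<otimes> inv z"
        using s by (auto simp: T conj_set_def)
      obtain v' y' where v'y': "v' \<in> V" "y' \<in> K" "d \<otimes> x = v' \<otimes> y'"
        using dK xbz(1) by blast
      have car: "x \<in> carrier G" "b \<in> carrier G" "z \<in> carrier G" "v' \<in> carrier G" "y' \<in> carrier G"
        using xbz v'y' K(2) BG VG by auto
      have "d \<otimes> s = (d \<otimes> x) \<otimes> b \<otimes> inv z"
        using xbz(4) car d(1) by (simp add: m_assoc)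
      also have "\<dots> = v' \<otimes> (y' \<otimes> b \<otimes> inv z)"
        using v'y'(3) car by (simp add: m_assoc)
      finally show ?thesis
        using v'y'(1) VT conj_mem[OF v'y'(2) xbz(2,3)] by (auto simp: T)
    qed
    ultimately show ?thesis
      using dead_end_of_length_2[OF SG d(1) w] by blast
  qed
qed

section \<open>Dead ends from powers of one element and from commuting elements of order
  three\<close>

text \<open>With \<open>K = {\<one>, d}\<close> the elements
  \<open>inv x \<otimes> d \<otimes> y\<close> are \<open>\<one>\<close>, \<open>d\<close> and
  \<open>d\<^sup>2\<close>, none of which may lie in \<open>A\<close> or its inverse. The condition
  \<open>d\<^sup>3 \<noteq> 1\<close> keeps \<open>d\<close> apart from the inverse of the letter
  \<open>d\<^sup>2\<close>.\<close>

lemma dead_end_cyclic: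
  assumes A: "finite_generating_set G A" "A \<noteq> {}" "\<one> \<notin> A"
    and d: "d \<in> carrier G" "d \<notin> A \<union> set_inv A" "d \<otimes> d \<notin> A \<union> set_inv A" "d \<otimes> d \<otimes> d \<noteq> \<one>"
  shows "\<exists>S. finite_generating_set G S \<and> card S \<le> 4 * card A + 2 \<and> (\<exists>d. dead_end G S d)"
proof -
  \<comment> \<open>If \<open>d\<^sup>4 = 1\<close>, then \<open>d\<^sup>3 = d\<inverse>\<close>
    would make \<open>d\<close> a letter. It can be left out, since
    \<open>d d\<^sup>2 = d\<inverse>\<close> is then a quotient of elements of
    \<open>K\<close>.\<close>
  define U where "U = insert (d \<otimes> d) (if d \<otimes> d \<otimes> d \<otimes> d = \<one> then {} else {d \<otimes> d \<otimes> d})"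
  define K where "K = {\<one>, d}"
  have AG: "A \<subseteq> carrier G" using A(1) by (simp add: finite_generating_set_def)
  have d1: "d \<noteq> \<one>" using d(4) by auto
  have one: "\<one> \<notin> A \<union> set_inv A"
    using A(3) AG by (auto simp: SET_INV_def subset_iff) (metis inv_eq_1_iff)
  have dV: "d \<notin> insert \<one> (U \<union> set_inv U)"
  proof -
    have "d \<noteq> d \<otimes> d" using d1 d(1) by simp
    moreover have "d = d \<otimes> d \<otimes> d \<Longrightarrow> d \<otimes> d \<otimes> d \<otimes> d = \<one>"
      using d(1) by (metis l_cancel_one' m_assoc m_closed)
    moreover have "d \<noteq> inv (d \<otimes> d)"
      using d(1,4) by (metis m_closed r_inv)
    moreover have "d = inv (d \<otimes> d \<otimes> d) \<Longrightarrow> d \<otimes> d \<otimes> d \<otimes> d = \<one>"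
      using d(1) by (metis m_closed r_inv)
    ultimately show ?thesis
      using d1 by (auto simp: U_def SET_INV_def split: if_splits)
  qed
  have dA: "inv x \<otimes> d \<otimes> y \<notin> A \<union> set_inv A" if "x \<in> K" "y \<in> K" for x y
    using that d one by (auto simp: K_def)
  have dK: "\<exists>v \<in> insert \<one> (U \<union> set_inv U). \<exists>y \<in> K. d \<otimes> x = v \<otimes> y" if "x \<in> K" for x
    using that d(1) by (auto simp: K_def U_def)
  have dU: "(\<exists>v \<in> insert \<one> (U \<union> set_inv U). \<exists>r \<in> insert \<one> (U \<union> set_inv U). d \<otimes> u = v \<otimes> r)
      \<or> (\<exists>x \<in> K. \<exists>y \<in> K. d \<otimes> u = x \<otimes> inv y)" if u: "u \<in> U \<union> set_inv U" for u
  proof -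
    have inv_d: "\<exists>x \<in> K. \<exists>y \<in> K. inv d = x \<otimes> inv y"
      using d(1) by (auto simp: K_def)
    have d4: "d \<otimes> (d \<otimes> d) = inv d" if "d \<otimes> d \<otimes> d \<otimes> d = \<one>"
      using that d(1) by (metis inv_equality m_assoc m_closed)
    have shifts: "d \<otimes> inv (d \<otimes> d) = inv d" "d \<otimes> inv (d \<otimes> d \<otimes> d) = \<one> \<otimes> inv (d \<otimes> d)"
      "d \<otimes> (d \<otimes> d) = \<one> \<otimes> (d \<otimes> d \<otimes> d)" "d \<otimes> (d \<otimes> d \<otimes> d) = (d \<otimes> d) \<otimes> (d \<otimes> d)"
      using d(1) by (simp_all add: inv_mult_group m_assoc)
    have mem: "d \<otimes> d \<otimes> d \<otimes> d \<noteq> \<one> \<Longrightarrow> d \<otimes> d \<otimes> d \<in> U" "d \<otimes> d \<in> U"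
      "inv (d \<otimes> d) \<in> set_inv U"
      by (auto simp: U_def SET_INV_def)
    consider "u = d \<otimes> d" "d \<otimes> d \<otimes> d \<otimes> d = \<one>" | "u = d \<otimes> d" "d \<otimes> d \<otimes> d \<otimes> d \<noteq> \<one>"
      | "u = inv (d \<otimes> d)" | "u = d \<otimes> d \<otimes> d" | "u = inv (d \<otimes> d \<otimes> d)"
      using u by (auto simp: U_def SET_INV_def split: if_splits)
    then show ?thesis
    proof cases
      case 1
      then show ?thesis using d4 inv_d by simp
    next
      case 2
      then show ?thesis using shifts(3) mem(1) by blast
    next
      case 3
      then show ?thesis using shifts(1) inv_d by simp
    next
      case 4
      then show ?thesis using shifts(4) mem(2) by blast
    next
      case 5
      then show ?thesis using shifts(2) mem(3) by blast
    qed
  qed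
  have "card U \<le> 2" by (simp add: U_def card_insert_if)
  moreover have "card K = 2" using d1 by (simp add: K_def)
  moreover have "finite U" "U \<subseteq> carrier G" "finite K" "K \<subseteq> carrier G" "\<one> \<in> K"
    using d(1) by (auto simp: U_def K_def)
  note dead_end_conj_set[OF A(1,2) this d(1) dV dA dK dU]
  ultimately show ?thesis by (intro exI[of _ "U \<union> conj_set K A"]) auto
qed

text \<open>In the plane over the field of three elements spanned by \<open>u\<close> and
  \<open>v\<close>, put \<open>d = (1,1)\<close> and \<open>c = (1,-1)\<close>. Then
  \<open>d = -v + c\<close> and \<open>d + c = -u\<close>, so \<open>d\<close> moves
  \<open>K = {0, c}\<close> into \<open>V + K\<close>, and the differences to be kept out of
  \<open>A\<close> and its inverse are \<open>d\<close>, \<open>-u\<close> and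
  \<open>-v\<close>.\<close>

lemma dead_end_commuting:
  assumes A: "finite_generating_set G A" "A \<noteq> {}"
    and uv: "u \<in> carrier G" "v \<in> carrier G" "u \<otimes> v = v \<otimes> u"
      "u \<otimes> u \<otimes> u = \<one>" "v \<otimes> v \<otimes> v = \<one>" "u \<noteq> \<one>" "v \<noteq> \<one>" "u \<noteq> v" "u \<noteq> inv v"
    and notin: "u \<notin> A \<union> set_inv A" "v \<notin> A \<union> set_inv A" "u \<otimes> v \<notin> A \<union> set_inv A"
  shows "\<exists>S. finite_generating_set G S \<and> card S \<le> 4 * card A + 2 \<and> (\<exists>d. dead_end G S d)"
proof -
  define U where "U = {u, v}"
  define d where "d = u \<otimes> v"
  define K where "K = {\<one>, u \<otimes> inv v}"
  have AG: "A \<subseteq> carrier G" using A(1) by (simp add: finite_generating_set_def)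
  have sym: "inv g \<notin> A \<union> set_inv A" if "g \<notin> A \<union> set_inv A" "g \<in> carrier G" for g
    using that AG by (auto simp: SET_INV_def subset_iff)
  have dG: "d \<in> carrier G" using uv by (simp add: d_def)
  have inv2: "inv u = u \<otimes> u" "inv v = v \<otimes> v"
    using uv by (auto intro: inv_equality)
  have comm: "v \<otimes> (u \<otimes> x) = u \<otimes> (v \<otimes> x)" if "x \<in> carrier G" for x
    using uv that by (simp flip: m_assoc)
  have cube: "u \<otimes> (u \<otimes> u) = \<one>" "v \<otimes> (v \<otimes> v) = \<one>"
    using uv(1,2,4,5) by (simp_all flip: m_assoc)
  have cube': "u \<otimes> (u \<otimes> (u \<otimes> x)) = x" "v \<otimes> (v \<otimes> (v \<otimes> x)) = x" if "x \<in> carrier G" for x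
    using uv(1,2,4,5) that by (simp_all flip: m_assoc)
  \<comment> \<open>These rules rewrite to the normal form \<open>u\<^sup>i v\<^sup>j\<close> with
    exponents below three: inverses become squares, \<open>u\<close> moves left and cubes
    cancel.\<close>
  note norm = m_assoc uv(1,2) uv(3)[symmetric] comm cube cube' inv2 inv_mult_group
  have dV: "d \<notin> insert \<one> (U \<union> set_inv U)"
  proof -
    have "d \<noteq> \<one>"
      unfolding d_def using uv(1,2,9) by (metis inv_equality)
    moreover have "d \<noteq> u" "d \<noteq> v"
      unfolding d_def using uv by simp_all
    moreover have "d \<noteq> inv u" "d \<noteq> inv v"
      unfolding d_def inv2 using uv by simp_all
    ultimately show ?thesis by (auto simp: U_def SET_INV_def)
  qed
  have dA: "inv x \<otimes> d \<otimes> y \<notin> A \<union> set_inv A" if "x \<in> K" "y \<in> K" for x y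
  proof -
    let ?c = "u \<otimes> inv v"
    have "inv \<one> \<otimes> d \<otimes> \<one> = d" "inv \<one> \<otimes> d \<otimes> ?c = inv u" "inv ?c \<otimes> d \<otimes> \<one> = inv v"
      "inv ?c \<otimes> d \<otimes> ?c = d"
      by (simp_all add: d_def norm)
    then have "inv x \<otimes> d \<otimes> y \<in> {d, inv u, inv v}"
      using that unfolding K_def by blast
    moreover have "d \<notin> A \<union> set_inv A" "inv u \<notin> A \<union> set_inv A" "inv v \<notin> A \<union> set_inv A"
      using notin(3) sym[OF notin(1) uv(1)] sym[OF notin(2) uv(2)] unfolding d_def by blast+
    ultimately show ?thesis by (elim insertE emptyE) (simp_all only: not_False_eq_True)
  qed
  have dK: "\<exists>w \<in> insert \<one> (U \<union> set_inv U). \<exists>y \<in> K. d \<otimes> x = w \<otimes> y" if "x \<in> K" for x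
  proof -
    have "d \<otimes> \<one> = inv v \<otimes> (u \<otimes> inv v)" "d \<otimes> (u \<otimes> inv v) = inv u \<otimes> \<one>"
      by (simp_all add: d_def norm)
    then show ?thesis
      using that unfolding K_def U_def SET_INV_def by blast
  qed
  have dU: "\<exists>w \<in> insert \<one> (U \<union> set_inv U). \<exists>r \<in> insert \<one> (U \<union> set_inv U). d \<otimes> s = w \<otimes> r"
    if "s \<in> U \<union> set_inv U" for s
  proof -
    have "d \<otimes> u = inv u \<otimes> v" "d \<otimes> v = u \<otimes> inv v" "d \<otimes> inv u = \<one> \<otimes> v" "d \<otimes> inv v = \<one> \<otimes> u"
      by (simp_all add: d_def norm)
    then show ?thesis
      using that unfolding U_def SET_INV_def by blast
  qed
  have "card U \<le> 2" by (simp add: U_def card_insert_if)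
  moreover have "card K = 2"
    using uv by (auto simp: K_def inv_solve_right)
  moreover have "finite U" "U \<subseteq> carrier G" "finite K" "K \<subseteq> carrier G" "\<one> \<in> K"
    using uv(1,2) by (auto simp: U_def K_def)
  note dead_end_conj_set[OF A this dG dV dA dK disjI1[OF dU]]
  ultimately show ?thesis by (intro exI[of _ "U \<union> conj_set K A"]) auto
qed

section \<open>Groups in which almost all cubes are trivial\<close>

text \<open>Replacing \<open>z z\<close> by \<open>z\<inverse>\<close> for \<open>z = y\<close>,
  \<open>x y\<close>, \<open>x y\<inverse>\<close> brings both sides to
  \<open>y x\<inverse> y\<inverse>\<close>. Asking for just these three cubes lets the identity
  apply when finitely many elements have nontrivial cube.\<close>

lemma commute_conjugate_of_cubes:
  assumes "x \<in> carrier G" "y \<in> carrier G"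
    and "y \<otimes> y \<otimes> y = \<one>" "x \<otimes> y \<otimes> (x \<otimes> y) \<otimes> (x \<otimes> y) = \<one>"
      "x \<otimes> inv y \<otimes> (x \<otimes> inv y) \<otimes> (x \<otimes> inv y) = \<one>"
  shows "x \<otimes> (inv y \<otimes> x \<otimes> y) = (inv y \<otimes> x \<otimes> y) \<otimes> x"
proof -
  note car = assms(1,2)
  have cube: "z \<otimes> z = inv z" if "z \<otimes> z \<otimes> z = \<one>" "z \<in> carrier G" for z
    using that by (simp add: inv_equality)
  have yy: "y \<otimes> y = inv y"
    using cube assms by blast
  have yy': "inv y \<otimes> inv y = y"
    using arg_cong[OF yy, of "m_inv G"] car by (simp add: inv_mult_group)
  have "x \<otimes> (inv y \<otimes> x \<otimes> y) = x \<otimes> inv y \<otimes> (x \<otimes> inv y) \<otimes> (y \<otimes> y)"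
    using car by (simp add: m_assoc)
  also have "\<dots> = y \<otimes> inv x \<otimes> inv y"
    using cube[OF assms(5)] car by (simp add: yy inv_mult_group)
  finally have 1: "x \<otimes> (inv y \<otimes> x \<otimes> y) = y \<otimes> inv x \<otimes> inv y" .
  have "(inv y \<otimes> x \<otimes> y) \<otimes> x = inv y \<otimes> (x \<otimes> y \<otimes> (x \<otimes> y)) \<otimes> inv y"
    using car by (simp add: m_assoc)
  also have "\<dots> = (inv y \<otimes> inv y) \<otimes> inv x \<otimes> inv y"
    using cube[OF assms(4)] car by (simp add: inv_mult_group m_assoc)
  finally show ?thesis using 1 by (simp add: yy')
qed

lemma finite_set_inv: "finite A \<Longrightarrow> finite (set_inv A)"
  by (simp add: SET_INV_def)

text \<open>For a fixed \<open>x\<close> of order three, a commuting partner comes from the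
  centralizer of \<open>x\<close> if the conjugacy class of \<open>x\<close> is finite, and from the
  class itself if it is infinite.\<close>

lemma dead_end_cofinite_cubes:
  assumes A: "finite_generating_set G A" "A \<noteq> {}"
    and "infinite (carrier G)" "finite {g \<in> carrier G. g \<otimes> g \<otimes> g \<noteq> \<one>}"
  shows "\<exists>S. finite_generating_set G S \<and> card S \<le> 4 * card A + 2 \<and> (\<exists>d. dead_end G S d)"
proof -
  define B where "B = A \<union> set_inv A"
  define F where "F = {g \<in> carrier G. g \<otimes> g \<otimes> g \<noteq> \<one>}"
  have fin: "finite B" "finite F"
    using A(1) assms(4) finite_set_inv by (auto simp: B_def F_def finite_generating_set_def)
  have BG: "B \<subseteq> carrier G"
    using A(1) by (auto simp: B_def SET_INV_def finite_generating_set_def)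
  have "infinite (carrier G - (F \<union> B \<union> {\<one>}))"
    using assms(3) fin by simp
  then obtain x where "x \<in> carrier G - (F \<union> B \<union> {\<one>})"
    by (meson infinite_imp_elem)
  then have x: "x \<in> carrier G" "x \<otimes> x \<otimes> x = \<one>" "x \<notin> B" "x \<noteq> \<one>"
    by (auto simp: F_def)
  \<comment> \<open>\<open>E\<close> collects the unsuitable partners \<open>v\<close>: those with
    \<open>v\<close> or \<open>x v\<close> in \<open>B\<close>, and the elements \<open>1\<close>,
    \<open>x\<close>, \<open>x\<inverse>\<close>.\<close>
  define E where "E = B \<union> (\<lambda>b. inv x \<otimes> b) ` B \<union> {\<one>, x, inv x}"
  have finE: "finite E" using fin by (simp add: E_def)
  have "\<exists>v \<in> carrier G. v \<notin> E \<and> v \<otimes> v \<otimes> v = \<one> \<and> x \<otimes> v = v \<otimes> x"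
  proof (cases "finite ((\<lambda>y. inv y \<otimes> x \<otimes> y) ` carrier G)")
    case True
    \<comment> \<open>Infinitely many \<open>y\<close> conjugate \<open>x\<close> to the same
      element as \<open>z\<close> does, and each \<open>y z\<inverse>\<close> then centralizes
      \<open>x\<close>.\<close>
    obtain z where z: "z \<in> carrier G"
      and inf: "infinite {y \<in> carrier G. inv y \<otimes> x \<otimes> y = inv z \<otimes> x \<otimes> z}"
      using pigeonhole_infinite[OF assms(3) True] by blast
    let ?Y = "{y \<in> carrier G. inv y \<otimes> x \<otimes> y = inv z \<otimes> x \<otimes> z}"
    have "inj_on (\<lambda>y. y \<otimes> inv z) ?Y"
      using z by (auto intro!: inj_onI)
    then have "infinite ((\<lambda>y. y \<otimes> inv z) ` ?Y)"
      using inf finite_imageD by blast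
    moreover have "(\<lambda>y. y \<otimes> inv z) ` ?Y \<subseteq> {v \<in> carrier G. x \<otimes> v = v \<otimes> x}"
    proof clarify
      fix y assume y: "y \<in> carrier G" "inv y \<otimes> x \<otimes> y = inv z \<otimes> x \<otimes> z"
      have "x \<otimes> (y \<otimes> inv z) = y \<otimes> (inv y \<otimes> x \<otimes> y) \<otimes> inv z"
        using x(1) y(1) z by (simp add: m_assoc)
      also have "\<dots> = y \<otimes> inv z \<otimes> x"
        unfolding y(2) using x(1) y(1) z by (simp add: m_assoc)
      finally show "y \<otimes> inv z \<in> carrier G \<and> x \<otimes> (y \<otimes> inv z) = y \<otimes> inv z \<otimes> x"
        using y(1) z by simp
    qed
    ultimately have "infinite {v \<in> carrier G. x \<otimes> v = v \<otimes> x}"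
      using finite_subset by blast
    then have "infinite ({v \<in> carrier G. x \<otimes> v = v \<otimes> x} - (F \<union> E))"
      using fin finE by simp
    then obtain v where "v \<in> {v \<in> carrier G. x \<otimes> v = v \<otimes> x} - (F \<union> E)"
      by (meson infinite_imp_elem)
    then show ?thesis by (auto simp: F_def)
  next
    case False
    let ?f = "\<lambda>y. inv y \<otimes> x \<otimes> y"
    \<comment> \<open>Outside \<open>N\<close> the elements \<open>y\<close>, \<open>x y\<close>, \<open>x y\<inverse>\<close> all have trivial cube.\<close>
    define N where "N = F \<union> (\<lambda>g. inv x \<otimes> g) ` F \<union> (\<lambda>g. inv g \<otimes> x) ` F"
    have "finite N" using fin by (simp add: N_def)
    \<comment> \<open>Discarding the finite set \<open>N\<close> of conjugators loses only finitely
      many conjugates.\<close>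
    moreover have "?f ` carrier G \<subseteq> ?f ` (carrier G - N) \<union> ?f ` N" by blast
    ultimately have "infinite (?f ` (carrier G - N))"
      using False finite_subset[of "?f ` carrier G"] by blast
    then have "infinite (?f ` (carrier G - N) - E)" using finE by simp
    then obtain v where "v \<in> ?f ` (carrier G - N) - E"
      by (meson infinite_imp_elem)
    then obtain y where y: "y \<in> carrier G" "y \<notin> N" "v = ?f y" "v \<notin> E" by blast
    have "y \<notin> F" "x \<otimes> y \<notin> F" "x \<otimes> inv y \<notin> F"
    proof -
      show "y \<notin> F" using y(2) by (simp add: N_def)
      have "y = inv x \<otimes> (x \<otimes> y)" "y = inv (x \<otimes> inv y) \<otimes> x"
        using x(1) y(1) by (simp_all add: inv_mult_group m_assoc)
      then show "x \<otimes> y \<notin> F" "x \<otimes> inv y \<notin> F"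
        using y(2) by (auto simp: N_def)
    qed
    then have "x \<otimes> v = v \<otimes> x"
      unfolding y(3) using x(1) y(1) by (intro commute_conjugate_of_cubes) (auto simp: F_def)
    moreover have "v \<otimes> v \<otimes> v = inv y \<otimes> (x \<otimes> x \<otimes> x) \<otimes> y"
      unfolding y(3) using x(1) y(1) by (simp add: m_assoc)
    ultimately show ?thesis
      using x(1,2) y by auto
  qed
  then obtain v where v: "v \<in> carrier G" "v \<notin> E" "v \<otimes> v \<otimes> v = \<one>" "x \<otimes> v = v \<otimes> x"
    by blast
  have "x \<otimes> v \<notin> B"
  proof
    assume "x \<otimes> v \<in> B"
    moreover have "v = inv x \<otimes> (x \<otimes> v)" using x(1) v(1) by simp
    ultimately show False using v(2) unfolding E_def by blast
  qed
  moreover have "x \<noteq> inv v"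
    using v(1,2) by (auto simp: E_def)
  ultimately show ?thesis
    using dead_end_commuting[OF A x(1) v(1) v(4) x(2) v(3) x(4)] v(2) x(3)
    by (auto simp: E_def B_def)
qed

section \<open>A generator with infinitely many square roots\<close>

text \<open>A square root \<open>d\<close> of \<open>a\<close> fails for \<open>A\<close> only
  because \<open>d\<^sup>2 = a\<close> is a generator, or for finitely many exceptional
  \<open>d\<close>. Trading \<open>a\<close> for \<open>a b\<close> cures the former without
  enlarging the set.\<close>

lemma dead_end_square_roots:
  assumes A: "finite_generating_set G A" "\<And>a. a \<in> A \<Longrightarrow> a \<notin> generate G (A - {a})"
    and "infinite (carrier G)" "a \<in> A" "infinite {d \<in> carrier G. d \<otimes> d = a}"
  shows "\<exists>S. finite_generating_set G S \<and> card S \<le> 4 * card A + 2 \<and> (\<exists>d. dead_end G S d)"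
proof (cases "A = {a}")
  case True
  have a: "a \<in> carrier G" using A(1) True by (simp add: finite_generating_set_def)
  have "ord a = 0"
    using generate_pow_card[OF a] A(1) True assms(3) by (simp add: finite_generating_set_def)
  then have pow: "a [^] n \<noteq> \<one>" if "n > 0" for n :: nat
    using pow_eq_id[OF a] that by simp
  \<comment> \<open>Here the group is infinite cyclic and \<open>d = a\<^sup>2\<close> works for
    \<open>A\<close> itself. Comparing \<open>d\<close> and \<open>d\<^sup>2\<close> with
    \<open>a\<close> and its inverse, and \<open>d\<^sup>3\<close> with \<open>1\<close>, involves
    the exponents 1, 3, 5 and 6.\<close>
  have pows: "a \<noteq> \<one>" "a \<otimes> a \<otimes> a \<noteq> \<one>" "a \<otimes> a \<otimes> a \<otimes> a \<otimes> a \<noteq> \<one>"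
    "a \<otimes> a \<otimes> a \<otimes> a \<otimes> a \<otimes> a \<noteq> \<one>"
    using pow[of 1] pow[of 3] pow[of 5] pow[of 6] a by (simp_all add: numeral_eq_Suc)
  let ?d = "a \<otimes> a"
  have "?d \<noteq> a" "?d \<noteq> inv a" "?d \<otimes> ?d \<noteq> a" "?d \<otimes> ?d \<noteq> inv a" "?d \<otimes> ?d \<otimes> ?d \<noteq> \<one>"
    using pows a by (auto simp: m_assoc)
  then show ?thesis
    using dead_end_cyclic[of A ?d] A(1) True a pows(1) by (simp add: SET_INV_def)
next
  case False
  then obtain b where b: "b \<in> A" "b \<noteq> a" using assms(4) by blast
  have AG: "A \<subseteq> carrier G" and finA: "finite A"
    using A(1) by (auto simp: finite_generating_set_def)
  then have ab: "a \<in> carrier G" "b \<in> carrier G" using b assms(4) by auto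
  define A' where "A' = insert (a \<otimes> b) (A - {a})"
  have A'G: "A' \<subseteq> carrier G" using ab AG by (auto simp: A'_def)
  have notin: "b \<notin> generate G (A - {b})" "a \<notin> generate G (A - {a})"
    using A(2) b assms(4) by auto
  have a_gen: "a \<in> generate G (A - {b})" "inv a \<in> generate G (A - {b})"
    using b assms(4) by (auto intro: generate.incl generate.inv)
  have "generate G A' = carrier G"
  proof
    show "generate G A' \<subseteq> carrier G" using generate_incl[OF A'G] .
    have "b \<in> generate G A'" "a \<otimes> b \<in> generate G A'" "inv b \<in> generate G A'"
      using b by (auto simp: A'_def intro: generate.incl generate.inv)
    then have "a \<otimes> b \<otimes> inv b \<in> generate G A'" by (auto intro: generate.eng)
    then have "a \<in> generate G A'" using ab by (simp add: m_assoc)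
    then have "A \<subseteq> generate G A'" by (auto simp: A'_def intro: generate.incl)
    then show "carrier G \<subseteq> generate G A'"
      using generate_subgroup_incl[OF _ generate_is_subgroup[OF A'G]] A(1)
      unfolding finite_generating_set_def by blast
  qed
  then have gen: "finite_generating_set G A'"
    using A'G finA by (simp add: finite_generating_set_def A'_def)
  have "card A' \<le> Suc (card (A - {a}))"
    by (simp add: A'_def card_insert_if finA)
  also have "\<dots> = card A"
    using card_Suc_Diff1[OF finA assms(4)] .
  finally have card: "card A' \<le> card A" .
  have one: "\<one> \<notin> A'"
  proof
    assume "\<one> \<in> A'"
    then consider "\<one> \<in> A" | "a \<otimes> b = \<one>" by (auto simp: A'_def)
    then show False
    proof cases
      case 1
      then show False using A(2) generate.one by blast
    next
      case 2
      then have "b = inv a" using ab by (metis inv_equality inv_inv)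
      then show False using notin a_gen by simp
    qed
  qed
  \<comment> \<open>Each possibility contradicts irredundancy: \<open>a = a b\<close> gives
    \<open>b = 1\<close>, \<open>a = c\<inverse>\<close> makes \<open>a\<close> redundant, and
    \<open>a = (a b)\<inverse>\<close> gives \<open>b = a\<^sup>-\<^sup>2\<close>.\<close>
  have a_notin: "a \<notin> A' \<union> set_inv A'"
  proof
    assume "a \<in> A' \<union> set_inv A'"
    then consider "a = a \<otimes> b" | c where "c \<in> A - {a}" "a = inv c" | "a = inv (a \<otimes> b)"
      unfolding A'_def SET_INV_def by blast
    then show False
    proof cases
      case 1
      then have "b = \<one>" using ab by simp
      then show False using notin(1) generate.one by metis
    next
      case 2
      then show False using notin(2) generate.inv by metis
    next
      case 3
      then have "inv a = a \<otimes> b" using ab by (metis inv_inv m_closed)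
      then have "b = inv a \<otimes> inv a" using ab by (metis cancel_inv(2))
      then show False using notin(1) a_gen(2) generate.eng by metis
    qed
  qed
  \<comment> \<open>Avoiding \<open>inv a\<close> secures \<open>d\<^sup>3 \<noteq> 1\<close>: from
    \<open>d\<^sup>2 = a\<close> and \<open>d\<^sup>3 = 1\<close> it would follow that
    \<open>d = a\<inverse>\<close>.\<close>
  have "infinite ({d \<in> carrier G. d \<otimes> d = a} - (A' \<union> set_inv A' \<union> {inv a}))"
    using assms(5) finA finite_set_inv[of A'] by (simp add: A'_def)
  then obtain d where "d \<in> {d \<in> carrier G. d \<otimes> d = a} - (A' \<union> set_inv A' \<union> {inv a})"
    by (meson infinite_imp_elem)
  then have d: "d \<in> carrier G" "d \<otimes> d = a" "d \<notin> A' \<union> set_inv A'" "d \<noteq> inv a" by auto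
  have "d \<otimes> d \<otimes> d \<noteq> \<one>"
    using d(1,2,4) ab(1) by (metis inv_equality inv_inv)
  then obtain S where "finite_generating_set G S" "card S \<le> 4 * card A' + 2" "\<exists>d. dead_end G S d"
    using dead_end_cyclic[OF gen _ one d(1,3)] a_notin unfolding d(2) A'_def by blast
  then show ?thesis
    using card by (intro exI[of _ S]) auto
qed

section \<open>Irredundant and minimal generating sets\<close>

text \<open>If no \<open>d\<close> suits the cyclic construction, every element outside
  \<open>B\<close> with nontrivial cube has its square in \<open>B\<close>. Either finitely many
  elements have their square in \<open>B\<close>, and almost all cubes are trivial, or by pigeonhole
  one element of \<open>B\<close> has infinitely many square roots.\<close>

lemma dead_end_irredundant:
  assumes A: "finite_generating_set G A" "\<And>a. a \<in> A \<Longrightarrow> a \<notin> generate G (A - {a})"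
    and inf: "infinite (carrier G)"
  shows "\<exists>S. finite_generating_set G S \<and> card S \<le> 4 * card A + 2 \<and> (\<exists>d. dead_end G S d)"
proof -
  define B where "B = A \<union> set_inv A"
  have AG: "A \<subseteq> carrier G" "finite A"
    using A(1) by (auto simp: finite_generating_set_def)
  have ne: "A \<noteq> {}"
  proof
    assume "A = {}"
    then have "carrier G \<subseteq> {\<one>}"
      using generate_subgroup_incl[of "{}" "{\<one>}"] triv_subgroup A(1)
      by (simp add: finite_generating_set_def)
    then show False using inf finite_subset by blast
  qed
  have one: "\<one> \<notin> A" using A(2) generate.one by blast
  have finB: "finite B" using AG finite_set_inv by (simp add: B_def)
  show ?thesis
  proof (cases "\<exists>d \<in> carrier G. d \<notin> B \<and> d \<otimes> d \<notin> B \<and> d \<otimes> d \<otimes> d \<noteq> \<one>")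
    case True
    then show ?thesis using dead_end_cyclic[OF A(1) ne one] unfolding B_def by blast
  next
    case none: False
    let ?Q = "{d \<in> carrier G. d \<otimes> d \<in> B}"
    show ?thesis
    proof (cases "finite ?Q")
      case True
      have "{g \<in> carrier G. g \<otimes> g \<otimes> g \<noteq> \<one>} \<subseteq> B \<union> ?Q" using none by blast
      then have "finite {g \<in> carrier G. g \<otimes> g \<otimes> g \<noteq> \<one>}"
        using True finB finite_subset by blast
      then show ?thesis using dead_end_cofinite_cubes[OF A(1) ne inf] by blast
    next
      case False
      have "\<exists>b \<in> B. infinite {d \<in> ?Q. d \<otimes> d = b}"
        by (rule pigeonhole_infinite_rel[OF False finB]) auto
      then obtain b where b: "b \<in> B" "infinite {d \<in> ?Q. d \<otimes> d = b}" by blast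
      then have inf_b: "infinite {d \<in> carrier G. d \<otimes> d = b}"
        by (rule_tac infinite_super[OF _ b(2)]) auto
      consider "b \<in> A" | a where "a \<in> A" "b = inv a"
        using b(1) by (auto simp: B_def SET_INV_def)
      then show ?thesis
      proof cases
        case 1
        then show ?thesis using dead_end_square_roots[OF A inf _ inf_b] by blast
      next
        case 2
        \<comment> \<open>Inversion carries the square roots of \<open>a\<inverse>\<close> to square
          roots of the generator \<open>a\<close>.\<close>
        have "inj_on (m_inv G) {d \<in> carrier G. d \<otimes> d = b}"
          by (auto intro!: inj_onI)
        then have "infinite (m_inv G ` {d \<in> carrier G. d \<otimes> d = b})"
          using inf_b finite_imageD by blast
        moreover have "m_inv G ` {d \<in> carrier G. d \<otimes> d = b} \<subseteq> {d \<in> carrier G. d \<otimes> d = a}"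
          using 2 AG(1) by (auto simp flip: inv_mult_group)
        ultimately have "infinite {d \<in> carrier G. d \<otimes> d = a}"
          using finite_subset by blast
        then show ?thesis using dead_end_square_roots[OF A inf 2(1)] by blast
      qed
    qed
  qed
qed

lemma irredundant_of_minimal_card:
  assumes A: "finite_generating_set G A"
    and min: "\<And>B. finite_generating_set G B \<Longrightarrow> card A \<le> card B"
    and a: "a \<in> A"
  shows "a \<notin> generate G (A - {a})"
proof
  assume a_gen: "a \<in> generate G (A - {a})"
  have AG: "A \<subseteq> carrier G" "finite A" "generate G A = carrier G"
    using A by (auto simp: finite_generating_set_def)
  then have sub: "A - {a} \<subseteq> carrier G" by blast
  have "A \<subseteq> generate G (A - {a})"
    using a_gen by (auto intro: generate.incl)
  then have "carrier G \<subseteq> generate G (A - {a})"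
    using generate_subgroup_incl[OF _ generate_is_subgroup[OF sub]] AG(3) by blast
  then have "finite_generating_set G (A - {a})"
    using sub AG(2) generate_incl[OF sub] by (auto simp: finite_generating_set_def)
  then have "card A \<le> card (A - {a})" by (rule min)
  then show False using a AG(2) card_Diff1_less[of A a] by linarith
qed

end

theorem theorem4:
  fixes G :: "('a, 'b) monoid_scheme"
  assumes "group G"
    and "infinite (carrier G)"
    and "\<exists>A. finite_generating_set G A"
  shows "(\<exists>S. finite_generating_set G S \<and> (\<exists>d. dead_end G S d)) \<and>
    (\<forall>m. (\<exists>A. finite_generating_set G A \<and> card A = m) \<longrightarrow>
      (\<exists>S. finite_generating_set G S \<and> card S \<le> 4 * m + 2 \<and> (\<exists>d. dead_end G S d)))"
proof -
  interpret group G by fact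
  \<comment> \<open>A generating set of least cardinality is irredundant, and the \<open>S\<close>
    built from it meets the bound for every \<open>m\<close> at once.\<close>
  obtain A where A: "finite_generating_set G A"
    and min: "\<And>B. finite_generating_set G B \<Longrightarrow> card A \<le> card B"
    using ex_has_least_nat[of "finite_generating_set G" _ card] assms(3) by blast
  obtain S where S: "finite_generating_set G S" "card S \<le> 4 * card A + 2" "\<exists>d. dead_end G S d"
    using dead_end_irredundant[OF A irredundant_of_minimal_card[OF A min] assms(2)] by blast
  have "card S \<le> 4 * card B + 2" if "finite_generating_set G B" for B
    using min[OF that] S(2) by linarith
  then show ?thesis using S by blast
qed

end
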